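(* Consider the flux reconstruction (FR) scheme (see context) with linear flux $\mathbf F=\mathbf a\otimes\mathbf u$, $\mathbf a\in\mathbb R^d$ constant, for which: $\mathbf W_\partial$ is diagonal with non-negative entries; for some $\kappa\in[0,1]$ the interface fluxes are $(\mathbf n\cdot F)^{\mathrm{num}\,\pm}_j=\tfrac12(\mathbf n_j^\pm\cdot\mathbf a)(u_j^\pm+u_j^\mp)-\tfrac12\kappa|\mathbf n_j^\pm\cdot\mathbf a|(u_j^\mp-u_j^\pm)$; and there is a matrix $\mathbf Q$ with $$\mathbf Q=\mathbf Q^T,\qquad \mathbf Q\mathbf D_{x_m}+\mathbf D_{x_m}^T\mathbf Q^T=0\ (1\le m\le d),\qquad \mathbf M+\mathbf Q\ \text{positive definite},\qquad \mathbf C=(\mathbf M+\mathbf Q)^{-1}\mathbf L_\partial^T\mathbf W_\partial .$$ If in addition $$\mathbf 1^T\mathbf M(\mathbf M+\mathbf Q)^{-1}\mathbf L_\partial^T\mathbf W_\partial=\mathbf 1^T\mathbf L_\partial^T\mathbf W_\partial,$$ then the scheme is conservative, in that on each element $$\frac{\mathrm d}{\mathrm dt}\mathbf 1^T\mathbf M\mathbf u=-\mathbf 1^T\mathbf L_\partial^T\mathbf W_\partial(\mathbf n\cdot\mathbf F)^{\mathrm{num}} .$$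
   Context: The domain in $\mathbb R^d$ is divided into a conforming mesh of affine elements. On each element the solution is a polynomial of total degree at most $k$, represented by its vector $\mathbf u\in\mathbb R^{N_s}$ of values at $N_s$ unisolvent solution points; $\mathbf 1$ is the vector of ones. $\mathbf M$ is the exact mass matrix of the Lagrange basis, $\mathbf D_{x_m}$ the exact nodal differentiation matrix in direction $x_m$, $\mathbf D=[\mathbf D_{x_1},\dots,\mathbf D_{x_d}]$, and $\mathbf G$ the vertical stacking of $\mathbf D_{x_1},\dots,\mathbf D_{x_d}$. Notation: $\hat{\mathbf A}=\mathbf I_d\otimes\mathbf A$. $\mathbf L_\partial$ interpolates nodal values to the flux points on the element boundary, $\mathbf W_\partial$ is the surface mass (quadrature) matrix, and $\mathbf N$ maps vector values at the flux points to their outward normal components. The summation-by-parts property holds: $\mathbf M\mathbf D+\mathbf G^T\hat{\mathbf M}=\mathbf L_\partial^T\mathbf W_\partial\mathbf N\hat{\mathbf L}_\partial$. The FR scheme on each element is $$\frac{\mathrm d\mathbf u}{\mathrm dt}=-\mathbf D\mathbf F-\mathbf C\big[(\mathbf n\cdot\mathbf F)^{\mathrm{num}}-\mathbf N\hat{\mathbf L}_\partial\mathbf F\big].$$ At an interface flux point $j$, $u_j^\pm$ are the values interpolated from the two adjacent elements and $\mathbf n_j^\pm$ their outward normals ($\mathbf n_j^+=-\mathbf n_j^-$). *)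

theory Defs
  imports "HOL-Analysis.Analysis"
begin

definition multi_indices :: "nat \<Rightarrow> ('d::finite \<Rightarrow> nat) set" where
  "multi_indices k = {\<alpha>. (\<Sum>m\<in>UNIV. \<alpha> m) \<le> k}"

lemma finite_multi_indices: "finite (multi_indices k :: ('d::finite \<Rightarrow> nat) set)"
proof (rule finite_subset)
  show "(multi_indices k :: ('d \<Rightarrow> nat) set) \<subseteq> PiE UNIV (\<lambda>_. {..k})"
  proof
    fix \<alpha> :: "'d \<Rightarrow> nat" assume "\<alpha> \<in> multi_indices k"
    moreover have "\<alpha> m \<le> (\<Sum>m\<in>UNIV. \<alpha> m)" for m
      by (rule member_le_sum) auto
    ultimately show "\<alpha> \<in> PiE UNIV (\<lambda>_. {..k})"
      by (auto simp: multi_indices_def intro: order_trans)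
  qed
qed (simp add: finite_PiE)

definition poly_space :: "nat \<Rightarrow> (real^'d \<Rightarrow> real) set" where
  "poly_space k = {p. \<exists>c :: ('d \<Rightarrow> nat) \<Rightarrow> real.
     p = (\<lambda>z. \<Sum>\<alpha>\<in>multi_indices k. c \<alpha> * (\<Prod>m\<in>UNIV. (z $ m) ^ \<alpha> m))}"

(* Unisolvence forces CARD('n) = N_s to be the dimension of poly_space k. *)
definition unisolvent :: "nat \<Rightarrow> ('n::finite \<Rightarrow> real^'d) \<Rightarrow> bool" where
  "unisolvent k x \<longleftrightarrow> (\<forall>v :: real^'n. \<exists>!p. p \<in> poly_space k \<and> (\<forall>i. p (x i) = v $ i))"

definition lagrange :: "nat \<Rightarrow> ('n::finite \<Rightarrow> real^'d) \<Rightarrow> 'n \<Rightarrow> real^'d \<Rightarrow> real" where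
  "lagrange k x j = (THE p. p \<in> poly_space k \<and> (\<forall>i. p (x i) = (if i = j then 1 else 0)))"

definition mass_matrix :: "nat \<Rightarrow> (real^'d) set \<Rightarrow> ('n::finite \<Rightarrow> real^'d) \<Rightarrow> real^'n^'n" where
  "mass_matrix k K x = (\<chi> i j. integral K (\<lambda>z. lagrange k x i z * lagrange k x j z))"

definition diff_matrix :: "nat \<Rightarrow> ('n::finite \<Rightarrow> real^'d) \<Rightarrow> 'd \<Rightarrow> real^'n^'n" where
  "diff_matrix k x m = (\<chi> i j. frechet_derivative (lagrange k x j) (at (x i)) (axis m 1))"

definition interp_matrix ::
    "nat \<Rightarrow> ('n::finite \<Rightarrow> real^'d) \<Rightarrow> ('f::finite \<Rightarrow> real^'d) \<Rightarrow> real^'n^'f" where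
  "interp_matrix k x y = (\<chi> j i. lagrange k x i (y j))"

(* Vectors consisting of one block per space direction are indexed by pairs
   (direction, point), direction first, as in the Kronecker product. *)

definition kron_mat ::
    "real^'b^'a \<Rightarrow> real^'q^'p \<Rightarrow> real^('b::finite \<times> 'q::finite)^('a::finite \<times> 'p::finite)" where
  "kron_mat A B = (\<chi> r c. A $ fst r $ fst c * B $ snd r $ snd c)"

definition kron_vec :: "real^'a \<Rightarrow> real^'p \<Rightarrow> real^('a::finite \<times> 'p::finite)" where
  "kron_vec a v = (\<chi> r. a $ fst r * v $ snd r)"

definition hat :: "real^'q^'p \<Rightarrow> real^('d::finite \<times> 'q::finite)^('d \<times> 'p::finite)" where
  "hat A = kron_mat (mat 1) A"

definition hcat :: "('d::finite \<Rightarrow> real^'q^'p) \<Rightarrow> real^('d \<times> 'q::finite)^'p::finite" where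
  "hcat A = (\<chi> i c. A (fst c) $ i $ snd c)"

definition vcat :: "('d::finite \<Rightarrow> real^'q^'p) \<Rightarrow> real^'q::finite^('d \<times> 'p::finite)" where
  "vcat A = (\<chi> r i. A (fst r) $ snd r $ i)"

definition normal_matrix :: "('f::finite \<Rightarrow> real^'d) \<Rightarrow> real^('d::finite \<times> 'f)^'f" where
  "normal_matrix n = (\<chi> j c. if snd c = j then n j $ fst c else 0)"

definition pos_def_matrix :: "real^'n^'n \<Rightarrow> bool" where
  "pos_def_matrix A \<longleftrightarrow> transpose A = A \<and> (\<forall>v. v \<noteq> 0 \<longrightarrow> 0 < v \<bullet> (A *v v))"

(* An affine element is a full-dimensional polytope (flat facets); the domain is
   the union of the elements K e. *)
definition conforming_mesh :: "('e \<Rightarrow> (real^'d) set) \<Rightarrow> bool" where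
  "conforming_mesh K \<longleftrightarrow>
     (\<forall>e. polytope (K e) \<and> interior (K e) \<noteq> {}) \<and>
     (\<forall>e e'. e \<noteq> e' \<longrightarrow> interior (K e) \<inter> interior (K e') = {} \<and>
        (K e \<inter> K e') face_of (K e) \<and> (K e \<inter> K e') face_of (K e'))"

(* A flux point is a point together with the facet it belongs to; the facet is
   recorded by the outward unit normal, so that a vertex may carry several flux points. *)
definition flux_facet :: "(real^'d) set \<Rightarrow> real^'d \<Rightarrow> real^'d \<Rightarrow> (real^'d) set" where
  "flux_facet S y n = S \<inter> {z. n \<bullet> (z - y) = 0}"

definition outward_unit_normal :: "(real^'d) set \<Rightarrow> real^'d \<Rightarrow> real^'d \<Rightarrow> bool" where
  "outward_unit_normal S y n \<longleftrightarrow>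
     y \<in> S \<and> norm n = 1 \<and> (\<forall>z\<in>S. n \<bullet> (z - y) \<le> 0) \<and> flux_facet S y n facet_of S"

(* The two sides of an interface flux point: the same physical point on a facet
   common to two distinct elements. *)
definition interface ::
    "('e \<Rightarrow> (real^'d) set) \<Rightarrow> ('e \<Rightarrow> 'f \<Rightarrow> real^'d) \<Rightarrow> ('e \<Rightarrow> 'f \<Rightarrow> real^'d) \<Rightarrow>
     'e \<Rightarrow> 'f \<Rightarrow> 'e \<Rightarrow> 'f \<Rightarrow> bool" where
  "interface K y n e j e' j' \<longleftrightarrow>
     e \<noteq> e' \<and> y e j = y e' j' \<and> n e j = - n e' j' \<and>
     flux_facet (K e) (y e j) (n e j) = flux_facet (K e') (y e' j') (n e' j')"

(* Flux points on a facet shared with another element occur on both sides; the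
   others lie on the boundary of the domain. *)
definition matching_flux_points ::
    "('e \<Rightarrow> (real^'d) set) \<Rightarrow> ('e \<Rightarrow> 'f \<Rightarrow> real^'d) \<Rightarrow> ('e \<Rightarrow> 'f \<Rightarrow> real^'d) \<Rightarrow> bool" where
  "matching_flux_points K y n \<longleftrightarrow>
     (\<forall>e j e'. e \<noteq> e' \<and> flux_facet (K e) (y e j) (n e j) \<subseteq> K e' \<longrightarrow>
        (\<exists>j'. interface K y n e j e' j'))"

(* Arguments: D, C, N, L on one element, the nodal flux F and the numerical
   normal flux f; the result is du/dt. *)
definition fr_rhs ::
    "real^('d::finite \<times> 'n)^'n \<Rightarrow> real^'f^'n \<Rightarrow> real^('d \<times> 'f)^'f \<Rightarrow> real^'n^'f \<Rightarrow>
     real^('d \<times> 'n::finite) \<Rightarrow> real^'f::finite \<Rightarrow> real^'n" where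
  "fr_rhs D C N L F f = - (D *v F) - C *v (f - N *v (hat L *v F))"

(* un is the normal velocity seen from the side with outward normal n^+; up is the
   value on that side and um the value on the other side. *)
definition interface_flux :: "real \<Rightarrow> real \<Rightarrow> real \<Rightarrow> real \<Rightarrow> real" where
  "interface_flux \<kappa> un up um = 1/2 * un * (up + um) - 1/2 * \<kappa> * \<bar>un\<bar> * (um - up)"

end

theory Submission
  imports Defs
begin

text \<open>
  Constants are polynomials, so by unisolvence the Lagrange basis sums to 1 and every
  differentiation matrix annihilates \<open>\<one>\<close>. Testing the summation-by-parts identity with
  \<open>\<one>\<close> therefore turns the volume term \<open>\<one>\<^sup>T M D F\<close> into the boundary term
  \<open>\<one>\<^sup>T L\<^sup>T W N L F\<close>, which the interior part of the correction term cancels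
  by the conservation condition.
\<close>

lemma one_in_poly_space: "(\<lambda>_. 1) \<in> (poly_space k :: (real^'d \<Rightarrow> real) set)"
proof -
  have "(\<Sum>\<alpha>\<in>multi_indices k. (if \<alpha> = (\<lambda>_. 0) then 1 else 0) * (\<Prod>m\<in>UNIV. (z $ m) ^ \<alpha> m)) = 1"
    for z :: "real^'d"
  proof -
    have "(\<Sum>\<alpha>\<in>multi_indices k. (if \<alpha> = (\<lambda>_. 0) then 1 else 0) * (\<Prod>m\<in>UNIV. (z $ m) ^ \<alpha> m))
        = (\<Sum>\<alpha>\<in>(multi_indices k :: ('d \<Rightarrow> nat) set). if \<alpha> = (\<lambda>_. 0) then 1 else 0)"
      by (intro sum.cong) auto
    also have "\<dots> = 1"
      by (simp add: sum.delta' finite_multi_indices) (simp add: multi_indices_def)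
    finally show ?thesis .
  qed
  then show ?thesis
    unfolding poly_space_def
    by (intro CollectI exI[where x = "\<lambda>\<alpha>. if \<alpha> = (\<lambda>_. 0) then 1 else 0"]) auto
qed

lemma sum_in_poly_space:
  fixes p :: "'a \<Rightarrow> real^'d \<Rightarrow> real"
  assumes "\<And>j. j \<in> A \<Longrightarrow> p j \<in> poly_space k"
  shows "(\<lambda>z. \<Sum>j\<in>A. p j z) \<in> poly_space k"
proof -
  \<comment> \<open>Coefficients are only known to exist for each \<open>j\<close> separately;
    choosing them simultaneously lets them be added monomial by monomial.\<close>
  have "\<exists>c. \<forall>j\<in>A. p j = (\<lambda>z. \<Sum>\<alpha>\<in>multi_indices k. c j \<alpha> * (\<Prod>m\<in>UNIV. (z $ m) ^ \<alpha> m))"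
    using assms unfolding poly_space_def by (intro bchoice) blast
  then obtain c where
    c: "\<And>j. j \<in> A \<Longrightarrow> p j = (\<lambda>z. \<Sum>\<alpha>\<in>multi_indices k. c j \<alpha> * (\<Prod>m\<in>UNIV. (z $ m) ^ \<alpha> m))"
    by blast
  have "(\<Sum>j\<in>A. p j z) = (\<Sum>\<alpha>\<in>multi_indices k. (\<Sum>j\<in>A. c j \<alpha>) * (\<Prod>m\<in>UNIV. (z $ m) ^ \<alpha> m))" for z
  proof -
    have "(\<Sum>j\<in>A. p j z)
        = (\<Sum>j\<in>A. \<Sum>\<alpha>\<in>multi_indices k. c j \<alpha> * (\<Prod>m\<in>UNIV. (z $ m) ^ \<alpha> m))"
      by (intro sum.cong) (auto simp: c)
    then show ?thesis
      by (simp add: sum.swap[of _ A] sum_distrib_right)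
  qed
  then show ?thesis
    unfolding poly_space_def
    by (intro CollectI exI[where x = "\<lambda>\<alpha>. \<Sum>j\<in>A. c j \<alpha>"] ext)
qed

text \<open>Needed because \<open>frechet_derivative\<close> is a choice operator, which yields the
  actual derivative only where one exists.\<close>

lemma poly_space_differentiable:
  assumes "p \<in> poly_space k"
  shows "p differentiable (at z)"
proof -
  \<comment> \<open>Induction on the set of coordinates that occur in a monomial; the full monomial
    is the case \<open>B = UNIV\<close>.\<close>
  have "(\<lambda>z. \<Prod>m\<in>B. (z $ m) ^ \<alpha> m) differentiable (at z)" if "finite B" for B :: "'a set" and \<alpha> :: "'a \<Rightarrow> nat"
    using that
    by induction (auto intro!: differentiable_mult differentiable_power
        bounded_linear_imp_differentiable[OF bounded_linear_vec_nth])
  with assms show ?thesis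
    unfolding poly_space_def
    by (auto intro!: differentiable_sum differentiable_mult simp: finite_multi_indices)
qed

text \<open>Unisolvence, applied to the \<open>j\<close>-th unit vector as nodal data, makes the
  definite description in \<open>lagrange\<close> denote.\<close>

lemma
  assumes "unisolvent k x"
  shows lagrange_in_poly_space: "lagrange k x j \<in> poly_space k"
    and lagrange_node: "lagrange k x j (x i) = (if i = j then 1 else 0)"
proof -
  have "\<exists>!p. p \<in> poly_space k \<and> (\<forall>i. p (x i) = (\<chi> i. if i = j then 1 else 0) $ i)"
    using assms unfolding unisolvent_def by blast
  then have "\<exists>!p. p \<in> poly_space k \<and> (\<forall>i. p (x i) = (if i = j then 1 else 0))"
    by simp
  from theI'[OF this]
  show "lagrange k x j \<in> poly_space k" "lagrange k x j (x i) = (if i = j then 1 else 0)"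
    unfolding lagrange_def by auto
qed

text \<open>Partition of unity: the sum and the constant 1 interpolate the same nodal data, so
  uniqueness of the interpolant makes them equal as functions, hence away from the nodes
  too.\<close>

lemma sum_lagrange:
  fixes x :: "'n::finite \<Rightarrow> real^'d"
  assumes "unisolvent k x"
  shows "(\<Sum>j\<in>UNIV. lagrange k x j z) = 1"
proof -
  let ?P = "\<lambda>p. p \<in> poly_space k \<and> (\<forall>i. p (x i) = (1 :: real^'n) $ i)"
  have "\<exists>!p. ?P p"
    using assms unfolding unisolvent_def by blast
  then have "\<exists>\<^sub>\<le>\<^sub>1p. ?P p"
    by (simp add: ex1_iff_ex_Uniq)
  moreover have "?P (\<lambda>z. \<Sum>j\<in>UNIV. lagrange k x j z)"
    by (simp add: sum_in_poly_space lagrange_in_poly_space lagrange_node assms)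
  moreover have "?P (\<lambda>_. 1)"
    by (simp add: one_in_poly_space)
  ultimately have "(\<lambda>z. \<Sum>j\<in>UNIV. lagrange k x j z) = (\<lambda>_. 1)"
    by (rule Uniq_D[where P = ?P])
  then show ?thesis
    by (rule fun_cong)
qed

text \<open>Entry \<open>i\<close> of the product is the derivative of the partition of unity at the
  node \<open>x i\<close>, and that function is constant.\<close>

lemma diff_matrix_mult_one:
  fixes x :: "'n::finite \<Rightarrow> real^'d"
  assumes "unisolvent k x"
  shows "diff_matrix k x m *v 1 = 0"
proof -
  have "(\<Sum>j\<in>UNIV. frechet_derivative (lagrange k x j) (at z) (axis m 1)) = 0" for z
  proof -
    have "(lagrange k x j has_derivative frechet_derivative (lagrange k x j) (at z)) (at z)" for j
      using poly_space_differentiable[OF lagrange_in_poly_space[OF assms]]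
      by (simp add: frechet_derivative_works)
    then have "((\<lambda>z. \<Sum>j\<in>UNIV. lagrange k x j z) has_derivative
        (\<lambda>h. \<Sum>j\<in>UNIV. frechet_derivative (lagrange k x j) (at z) h)) (at z)"
      by (intro has_derivative_sum)
    then have "((\<lambda>_. 1) has_derivative
        (\<lambda>h. \<Sum>j\<in>UNIV. frechet_derivative (lagrange k x j) (at z) h)) (at z)"
      by (simp add: sum_lagrange[OF assms])
    from has_derivative_unique[OF this has_derivative_const]
    show ?thesis by (rule fun_cong)
  qed
  then show ?thesis
    by (simp add: diff_matrix_def matrix_vector_mult_def vec_eq_iff)
qed

lemma vcat_mult_one:
  assumes "\<And>m. A m *v 1 = 0"
  shows "vcat A *v 1 = 0"
  using assms by (simp add: vcat_def matrix_vector_mult_def vec_eq_iff)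

text \<open>The purely algebraic core; \<open>B\<close> plays the role of
  \<open>transpose L ** W\<close>.\<close>

lemma fr_rhs_conservative:
  fixes M P :: "real^'n^'n" and D :: "real^('d::finite \<times> 'n)^'n"
    and B :: "real^'f^'n" and N :: "real^('d \<times> 'f)^'f" and L :: "real^'n^'f"
  assumes sbp: "M ** D + transpose G ** hat M = B ** N ** hat L"
    and G: "G *v 1 = 0"
    and cons: "1 v* (M ** C) = 1 v* B"
  shows "1 \<bullet> (M *v fr_rhs D C N L F f) = - (1 \<bullet> (B *v f))"
proof -
  \<comment> \<open>This is the transpose of \<open>G *v 1 = 0\<close>; it removes the second
    summation-by-parts term after testing with the ones vector.\<close>
  have "1 v* transpose G = 0"
    using G by simp
  then have "1 \<bullet> ((transpose G ** hat M) *v F) = 0"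
    by (metis dot_lmul_matrix inner_zero_left matrix_vector_mul_assoc)
  moreover have "(M ** D) *v F + (transpose G ** hat M) *v F = B *v (N *v (hat L *v F))"
    by (metis sbp matrix_vector_mul_assoc matrix_vector_mult_add_rdistrib)
  ultimately have volume: "1 \<bullet> (M *v (D *v F)) = 1 \<bullet> (B *v (N *v (hat L *v F)))"
    by (metis add.right_neutral inner_add_right[of 1] matrix_vector_mul_assoc)
  \<comment> \<open>Used with \<open>w = f - N *v (hat L *v F)\<close>: its interior part yields the
    boundary term from \<open>volume\<close> with the opposite sign, leaving only
    \<open>f\<close>.\<close>
  have "1 \<bullet> (M *v (C *v w)) = 1 \<bullet> (B *v w)" for w
    by (metis cons dot_lmul_matrix matrix_vector_mul_assoc)
  with volume show ?thesis
    by (simp add: fr_rhs_def algebra_simps)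
qed

theorem lemma3p8:
  fixes k :: nat
    and K :: "'e \<Rightarrow> (real^'d) set"
    and x :: "'e \<Rightarrow> 'n::finite \<Rightarrow> real^'d"
    and y n :: "'e \<Rightarrow> 'f::finite \<Rightarrow> real^'d"
    and M Q :: "'e \<Rightarrow> real^'n^'n"
    and Dx :: "'e \<Rightarrow> 'd \<Rightarrow> real^'n^'n"
    and D :: "'e \<Rightarrow> real^('d \<times> 'n)^'n"
    and G :: "'e \<Rightarrow> real^'n^('d \<times> 'n)"
    and L :: "'e \<Rightarrow> real^'n^'f"
    and N :: "'e \<Rightarrow> real^('d \<times> 'f)^'f"
    and W :: "'e \<Rightarrow> real^'f^'f"
    and C :: "'e \<Rightarrow> real^'f^'n"
    and a :: "real^'d" and \<kappa> :: real
    and T :: "real set"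
    and u :: "real \<Rightarrow> 'e \<Rightarrow> real^'n"
    and fnum :: "real \<Rightarrow> 'e \<Rightarrow> real^'f"
  assumes mesh: "conforming_mesh K"
    and solution_points: "\<And>e. unisolvent k (x e)" "\<And>e i. x e i \<in> K e"
    and flux_points: "\<And>e j. outward_unit_normal (K e) (y e j) (n e j)"
      "matching_flux_points K y n"
    and M: "\<And>e. M e = mass_matrix k (K e) (x e)"
    and Dx: "\<And>e m. Dx e m = diff_matrix k (x e) m"
    and D: "\<And>e. D e = hcat (Dx e)"
    and G: "\<And>e. G e = vcat (Dx e)"
    and L: "\<And>e. L e = interp_matrix k (x e) (y e)"
    and N: "\<And>e. N e = normal_matrix (n e)"
    and SBP: "\<And>e. M e ** D e + transpose (G e) ** hat (M e)
                   = transpose (L e) ** W e ** N e ** hat (L e)"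
    and W: "\<And>e i j. i \<noteq> j \<Longrightarrow> W e $ i $ j = 0" "\<And>e j. 0 \<le> W e $ j $ j"
    and FR: "\<And>t e. t \<in> T \<Longrightarrow>
        ((\<lambda>s. u s e) has_vector_derivative
           fr_rhs (D e) (C e) (N e) (L e) (kron_vec a (u t e)) (fnum t e)) (at t within T)"
    and \<kappa>: "0 \<le> \<kappa>" "\<kappa> \<le> 1"
    and flux: "\<And>t e j e' j'. t \<in> T \<Longrightarrow> interface K y n e j e' j' \<Longrightarrow>
        fnum t e $ j = interface_flux \<kappa> (n e j \<bullet> a) ((L e *v u t e) $ j) ((L e' *v u t e') $ j')"
    and Q_sym: "\<And>e. Q e = transpose (Q e)"
    and Q_D: "\<And>e m. Q e ** Dx e m + transpose (Dx e m) ** transpose (Q e) = 0"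
    and MQ: "\<And>e. pos_def_matrix (M e + Q e)"
    and C: "\<And>e. C e = matrix_inv (M e + Q e) ** transpose (L e) ** W e"
    and conservation_condition:
      "\<And>e. 1 v* (M e ** matrix_inv (M e + Q e) ** transpose (L e) ** W e)
          = 1 v* (transpose (L e) ** W e)"
  shows "\<forall>e. \<forall>t\<in>T. ((\<lambda>s. 1 \<bullet> (M e *v u s e)) has_real_derivative
           - (1 \<bullet> ((transpose (L e) ** W e) *v fnum t e))) (at t within T)"
proof (intro allI ballI)
  fix e t assume "t \<in> T"
  have "G e *v 1 = 0"
    unfolding G by (intro vcat_mult_one) (simp add: Dx diff_matrix_mult_one solution_points)
  moreover have "1 v* (M e ** C e) = 1 v* (transpose (L e) ** W e)"
    using conservation_condition by (simp add: C matrix_mul_assoc)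
  ultimately have rhs: "1 \<bullet> (M e *v fr_rhs (D e) (C e) (N e) (L e) (kron_vec a (u t e)) (fnum t e))
      = - (1 \<bullet> ((transpose (L e) ** W e) *v fnum t e))"
    by (rule fr_rhs_conservative[OF SBP])
  \<comment> \<open>\<open>M e\<close> does not depend on time, so this functional commutes with the
    time derivative and can be applied directly to the right-hand side of the scheme.\<close>
  have "bounded_linear (\<lambda>v. 1 \<bullet> (M e *v v))"
    by (intro bounded_linear_compose[OF bounded_linear_inner_right] matrix_vector_mul_bounded_linear)
  from bounded_linear.has_vector_derivative[OF this FR[OF \<open>t \<in> T\<close>, of e]]
  show "((\<lambda>s. 1 \<bullet> (M e *v u s e)) has_real_derivative
      - (1 \<bullet> ((transpose (L e) ** W e) *v fnum t e))) (at t within T)"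
    by (simp add: rhs has_real_derivative_iff_has_vector_derivative)
qed

end
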